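(* Let $e\in(0,1)$, let $T$ be a $t$-norm, let $S_M(x,y)=\max(x,y)$ and $T_M(x,y)=\min(x,y)$ on $[0,1]$, and let $U$ be the uninorm with identity element $e$ given by $$U(x,y)=\begin{cases} e\,T\!\left(\frac{x}{e},\frac{y}{e}\right), & (x,y)\in[0,e]^2,\\[2pt] e+(1-e)\,S_M\!\left(\frac{x-e}{1-e},\frac{y-e}{1-e}\right), & (x,y)\in[e,1]^2,\\[2pt] \min(x,y), & \text{otherwise.}\end{cases}$$ Let $\sigma:[0,1]\to[0,1]$ be a fuzzy subset and $B=\{x\in[0,1]:\sigma(x)\in[e,1]\}$. Then $\sigma$ is a $U$-fuzzy $t$-subnorm of $([0,1],T_M)$ if and only if $\sigma$ is decreasing on $B$ (i.e. $x,y\in B$ and $x\le y$ imply $\sigma(y)\le\sigma(x)$) and $\sigma(1)=1$.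
   Context: A $t$-norm is a commutative, associative, coordinatewise non-decreasing operation on $[0,1]$ with identity $1$. A uninorm is a commutative, associative, coordinatewise non-decreasing operation on $[0,1]$ with an identity element in $[0,1]$. A $U$-fuzzy $t$-subnorm of $([0,1],T_M)$ is a map $\sigma:[0,1]\to[0,1]$ with $U(\sigma(x),\sigma(y))\le\sigma(T_M(x,y))$ for all $x,y\in[0,1]$ and $\sigma(1)=1$. *)

theory Defs
  imports Complex_Main "HOL-Library.FuncSet"
begin

text \<open>Operations on \<open>[0,1]\<close> are total functions on the reals of which only the values
  on \<open>{0..1}\<close> matter: all requirements are relativised to \<open>{0..1}\<close>.\<close>

definition monotone_comm_semigroup :: "(real \<Rightarrow> real \<Rightarrow> real) \<Rightarrow> bool" where
  "monotone_comm_semigroup F \<longleftrightarrow>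
     (\<forall>x\<in>{0..1}. \<forall>y\<in>{0..1}. F x y \<in> {0..1}) \<and>
     (\<forall>x\<in>{0..1}. \<forall>y\<in>{0..1}. F x y = F y x) \<and>
     (\<forall>x\<in>{0..1}. \<forall>y\<in>{0..1}. \<forall>z\<in>{0..1}. F (F x y) z = F x (F y z)) \<and>
     (\<forall>x\<in>{0..1}. \<forall>y\<in>{0..1}. \<forall>z\<in>{0..1}. y \<le> z \<longrightarrow> F x y \<le> F x z \<and> F y x \<le> F z x)"

definition uninorm_with_identity :: "real \<Rightarrow> (real \<Rightarrow> real \<Rightarrow> real) \<Rightarrow> bool" where
  "uninorm_with_identity e U \<longleftrightarrow>
     monotone_comm_semigroup U \<and> e \<in> {0..1} \<and> (\<forall>x\<in>{0..1}. U e x = x \<and> U x e = x)"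

definition t_norm :: "(real \<Rightarrow> real \<Rightarrow> real) \<Rightarrow> bool" where
  "t_norm T \<longleftrightarrow> uninorm_with_identity 1 T"

definition fuzzy_t_subnorm ::
    "(real \<Rightarrow> real \<Rightarrow> real) \<Rightarrow> (real \<Rightarrow> real \<Rightarrow> real) \<Rightarrow> (real \<Rightarrow> real) \<Rightarrow> bool" where
  "fuzzy_t_subnorm U T \<sigma> \<longleftrightarrow>
     \<sigma> \<in> {0..1} \<rightarrow> {0..1} \<and>
     (\<forall>x\<in>{0..1}. \<forall>y\<in>{0..1}. U (\<sigma> x) (\<sigma> y) \<le> \<sigma> (T x y)) \<and> \<sigma> 1 = 1"

text \<open>The two closed squares overlap only in \<open>(e,e)\<close>, where both formulas give \<open>e\<close>
  (for a t-norm \<open>T\<close> and an operation \<open>S\<close> with \<open>S 0 0 = 0\<close>).\<close>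

definition uninorm_of ::
    "real \<Rightarrow> (real \<Rightarrow> real \<Rightarrow> real) \<Rightarrow> (real \<Rightarrow> real \<Rightarrow> real) \<Rightarrow> real \<Rightarrow> real \<Rightarrow> real" where
  "uninorm_of e T S x y =
     (if (x, y) \<in> {0..e} \<times> {0..e} then e * T (x / e) (y / e)
      else if (x, y) \<in> {e..1} \<times> {e..1} then e + (1 - e) * S ((x - e) / (1 - e)) ((y - e) / (1 - e))
      else min x y)"

text \<open>With \<open>S = max\<close> this is indeed a uninorm with identity \<open>e\<close>.\<close>

lemma uninorm_of_max:
  fixes e :: real and T :: "real \<Rightarrow> real \<Rightarrow> real"
  assumes e: "0 < e" "e < 1" and T: "t_norm T"
  shows "uninorm_with_identity e (uninorm_of e T max)"
proof -
  let ?U = "uninorm_of e T max"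
  define t where "t x y = e * T (x / e) (y / e)" for x y
  have Tc: "F \<in> {0..1} \<Longrightarrow> G \<in> {0..1} \<Longrightarrow> T F G \<in> {0..1}"
    and Tcom: "F \<in> {0..1} \<Longrightarrow> G \<in> {0..1} \<Longrightarrow> T F G = T G F"
    and Tas: "F \<in> {0..1} \<Longrightarrow> G \<in> {0..1} \<Longrightarrow> H \<in> {0..1} \<Longrightarrow> T (T F G) H = T F (T G H)"
    and Tmo: "F \<in> {0..1} \<Longrightarrow> G \<in> {0..1} \<Longrightarrow> H \<in> {0..1} \<Longrightarrow> G \<le> H \<Longrightarrow> T F G \<le> T F H"
    and T1: "F \<in> {0..1} \<Longrightarrow> T F 1 = F" for F G H
    using T unfolding t_norm_def uninorm_with_identity_def monotone_comm_semigroup_def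
    by blast+
  have sc: "x / e \<in> {0..1}" if "x \<in> {0..e}" for x
    using that e by (auto simp: divide_simps)
  have tcom: "t x y = t y x" if "x \<in> {0..e}" "y \<in> {0..e}" for x y
    unfolding t_def using Tcom[OF sc sc] that by simp
  have t0: "0 \<le> t x y" if "x \<in> {0..e}" "y \<in> {0..e}" for x y
    unfolding t_def using Tc[OF sc sc] that e by auto
  have tmo: "t x y \<le> t x z" if "x \<in> {0..e}" "y \<in> {0..e}" "z \<in> {0..e}" "y \<le> z" for x y z
  proof -
    have "y / e \<le> z / e" using that e by (simp add: divide_right_mono)
    then show ?thesis
      unfolding t_def using Tmo[OF sc sc sc, of x y z] that e by (simp add: mult_left_mono)
  qed
  have te: "t x e = x" if "x \<in> {0..e}" for x
    unfolding t_def using T1[OF sc] that e by auto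
  have tle1: "t x y \<le> x" if "x \<in> {0..e}" "y \<in> {0..e}" for x y
    using tmo[of x y e] te[of x] that e by auto
  have tle2: "t x y \<le> y" if "x \<in> {0..e}" "y \<in> {0..e}" for x y
    using tle1[of y x] tcom that by auto
  have tas: "t (t x y) z = t x (t y z)" if "x \<in> {0..e}" "y \<in> {0..e}" "z \<in> {0..e}" for x y z
    unfolding t_def using Tas[OF sc sc sc] that e by simp
  have Umax: "e + (1 - e) * max ((x - e) / (1 - e)) ((y - e) / (1 - e)) = max x y" for x y
    using e by (auto simp: max_def divide_simps)
  have U: "?U x y = (if x \<le> e \<and> y \<le> e then t x y else if e \<le> x \<and> e \<le> y then max x y else min x y)"
    if "x \<in> {0..1}" "y \<in> {0..1}" for x y
    using that Umax[of x y] unfolding uninorm_of_def t_def by auto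
  have id: "?U x e = x" if "x \<in> {0..1}" for x
    using that e te[of x] U[of x e] by auto
  have com: "?U x y = ?U y x" if "x \<in> {0..1}" "y \<in> {0..1}" for x y
    using that tcom[of x y] U by (auto simp: max.commute min.commute)
  have cl: "?U x y \<in> {0..1}" if "x \<in> {0..1}" "y \<in> {0..1}" for x y
    using that t0[of x y] tle1[of x y] U[OF that] by (auto simp: max_def min_def)
  have mo: "?U x y \<le> ?U x z" if a: "x \<in> {0..1}" "y \<in> {0..1}" "z \<in> {0..1}" "y \<le> z" for x y z
    using that tle1[of x y] tle2[of x y] tmo[of x y z] U[OF a(1,2)] U[OF a(1,3)]
      te[of x] tcom[of x e] te[of z] te[of y]
    by (auto simp: max_def min_def split: if_splits)
  have lt: "?U x y = t x y \<and> ?U x y < e \<and> 0 \<le> ?U x y"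
    if "x \<in> {0..1}" "y \<in> {0..1}" "x < e" "y < e" for x y
    using that t0[of x y] tle1[of x y] U[of x y] by auto
  have gt: "?U x y = max x y" if "x \<in> {0..1}" "y \<in> {0..1}" "x > e" "y > e" for x y
    using that U[of x y] by auto
  have mx: "?U x y = x" "?U y x = x" if "x \<in> {0..1}" "y \<in> {0..1}" "x < e" "y > e" for x y
    using that U[of x y] U[of y x] by auto
  have id': "?U e x = x" if "x \<in> {0..1}" for x
    using com[of e x] id that e by auto
  have as: "?U (?U x y) z = ?U x (?U y z)"
    if a: "x \<in> {0..1}" "y \<in> {0..1}" "z \<in> {0..1}" for x y z
  proof -
    consider "x = e" | "y = e" | "z = e" | "x \<noteq> e" "y \<noteq> e" "z \<noteq> e" by blast
    then show ?thesis
    proof cases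
      case 1 then show ?thesis using id'[of y] id'[of "?U y z"] cl[of y z] a by simp
    next
      case 2 then show ?thesis using id[of x] id'[of z] a by simp
    next
      case 3 then show ?thesis using id[of y] id[of "?U x y"] cl[of x y] a by simp
    next
      case 4
      then have "x < e \<or> e < x" "y < e \<or> e < y" "z < e \<or> e < z" by auto
      then consider "x < e" "y < e" "z < e" | "x < e" "y < e" "e < z" | "x < e" "e < y" "z < e"
        | "x < e" "e < y" "e < z" | "e < x" "y < e" "z < e" | "e < x" "y < e" "e < z"
        | "e < x" "e < y" "z < e" | "e < x" "e < y" "e < z" by blast
      then show ?thesis
      proof cases
        case 1
        then have "t x y < e" "t y z < e" "0 \<le> t x y" "0 \<le> t y z"
          using lt[of x y] lt[of y z] a by simp_all
        then have "?U (t x y) z = t (t x y) z" "?U x (t y z) = t x (t y z)"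
          using lt[of "t x y" z] lt[of x "t y z"] a 1 e by simp_all
        then show ?thesis using 1 a lt[of x y] lt[of y z] tas[of x y z] by simp
      next
        case 2
        then have "?U x y < e" "?U x y \<in> {0..1}" using lt[of x y] cl[of x y] a by simp_all
        then show ?thesis using 2 a mx by simp
      next
        case 5
        then have "?U y z < e" "?U y z \<in> {0..1}" using lt[of y z] cl[of y z] a by simp_all
        then show ?thesis using 5 a mx by simp
      next
        case 3
        then show ?thesis using a mx by simp
      next
        case 4
        then show ?thesis using a mx gt cl[of y z] by (simp add: max_def)
      next
        case 6
        then show ?thesis using a mx by simp
      next
        case 7
        then show ?thesis using a mx gt by (simp add: max_def)
      next
        case 8
        then show ?thesis using a gt by (simp add: max_def)
      qed
    qed
  qed
  have mo': "?U y x \<le> ?U z x" if "x \<in> {0..1}" "y \<in> {0..1}" "z \<in> {0..1}" "y \<le> z" for x y z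
    using mo[OF that] com[of x y] com[of x z] that by simp
  show ?thesis
    unfolding uninorm_with_identity_def monotone_comm_semigroup_def
  proof (intro conjI ballI impI)
    show "e \<in> {0..1}" using e by auto
  qed (fact cl com as mo mo' id id' | rule cl com as mo mo' id id'; assumption)+
qed

end

theory Submission
  imports Defs
begin

text \<open>On \<open>[e,1]\<^sup>2\<close> the uninorm is \<open>max\<close> and everywhere else it lies below \<open>min\<close>. So the
  subnorm inequality at \<open>x \<le> y\<close> is automatic unless both points belong to \<open>B\<close>, where it reads
  \<open>max (\<sigma> x) (\<sigma> y) \<le> \<sigma> x\<close>, that is, \<open>\<sigma> y \<le> \<sigma> x\<close>.\<close>

text \<open>By monotonicity, raising either argument to the identity \<open>1\<close> can only
  increase the value.\<close>

lemma t_norm_le_min: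
  assumes T: "t_norm T" and x: "x \<in> {0..1}" and y: "y \<in> {0..1}"
  shows "T x y \<le> min x y"
proof -
  have mono: "\<forall>x\<in>{0..1}. \<forall>y\<in>{0..1}. \<forall>z\<in>{0..1}. y \<le> z \<longrightarrow> T x y \<le> T x z \<and> T y x \<le> T z x"
    and unit: "\<forall>x\<in>{0..1}. T 1 x = x \<and> T x 1 = x"
    using T unfolding t_norm_def uninorm_with_identity_def monotone_comm_semigroup_def by blast+
  have "T x y \<le> T x 1" "T x y \<le> T 1 y"
    using mono x y by auto
  then show ?thesis
    using unit x y by simp
qed

text \<open>The increasing affine map from [0,1] onto [e,1] commutes with \<open>max\<close>. The
  corner \<open>(e, e)\<close> is separate: the branch of \<open>T\<close> takes precedence there
  and gives \<open>e * T 1 1 = e\<close>.\<close>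

lemma uninorm_of_eq_max:
  assumes e: "e \<in> {0<..<1}" and T: "t_norm T" and x: "x \<in> {e..1}" and y: "y \<in> {e..1}"
  shows "uninorm_of e T max x y = max x y"
proof (cases "x = e \<and> y = e")
  case True
  moreover have "T 1 1 = 1"
    using T unfolding t_norm_def uninorm_with_identity_def by simp
  ultimately show ?thesis
    using e by (simp add: uninorm_of_def)
next
  case False
  have "e + (1 - e) * max ((x - e) / (1 - e)) ((y - e) / (1 - e)) = max x y"
    using e by (auto simp: max_def divide_simps)
  then show ?thesis
    using False x y by (auto simp: uninorm_of_def)
qed

text \<open>A coordinate below \<open>e\<close> rules out the branch of \<open>S\<close>. On the
  lower square the bound is \<open>t_norm_le_min\<close> rescaled by \<open>e\<close>; elsewhere the
  value is \<open>min x y\<close> itself.\<close>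

lemma uninorm_of_le_min:
  assumes e: "e > 0" and T: "t_norm T" and x: "x \<in> {0..1}" and y: "y \<in> {0..1}"
    and less: "x < e \<or> y < e"
  shows "uninorm_of e T S x y \<le> min x y"
proof (cases "(x, y) \<in> {0..e} \<times> {0..e}")
  case True
  then have "T (x / e) (y / e) \<le> min (x / e) (y / e)"
    using e by (intro t_norm_le_min[OF T]) auto
  then have "e * T (x / e) (y / e) \<le> min x y"
    using e by (simp add: le_divide_eq mult.commute)
  then show ?thesis
    using True by (simp add: uninorm_of_def)
next
  case False
  then show ?thesis
    using less by (auto simp: uninorm_of_def)
qed

theorem proposition3p5:
  fixes e :: real and T :: "real \<Rightarrow> real \<Rightarrow> real" and \<sigma> :: "real \<Rightarrow> real"
    and U :: "real \<Rightarrow> real \<Rightarrow> real" and B :: "real set"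
  assumes "e \<in> {0<..<1}"
    and "t_norm T"
    and "\<sigma> \<in> {0..1} \<rightarrow> {0..1}"
  defines "U \<equiv> uninorm_of e T max"
    and "B \<equiv> {x \<in> {0..1}. \<sigma> x \<in> {e..1}}"
  shows "fuzzy_t_subnorm U min \<sigma> \<longleftrightarrow> antimono_on B \<sigma> \<and> \<sigma> 1 = 1"
proof
  assume L: "fuzzy_t_subnorm U min \<sigma>"
  have "\<sigma> y \<le> \<sigma> x" if xy: "x \<in> B" "y \<in> B" "x \<le> y" for x y
  proof -
    have "\<sigma> y \<le> max (\<sigma> x) (\<sigma> y)" by simp
    also have "\<dots> = U (\<sigma> x) (\<sigma> y)"
      using uninorm_of_eq_max[OF assms(1,2)] xy unfolding U_def B_def by simp
    also have "\<dots> \<le> \<sigma> (min x y)"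
      using L xy unfolding fuzzy_t_subnorm_def B_def by blast
    finally show ?thesis using xy(3) by simp
  qed
  then show "antimono_on B \<sigma> \<and> \<sigma> 1 = 1"
    using L unfolding fuzzy_t_subnorm_def by (auto intro: monotone_onI)
next
  assume R: "antimono_on B \<sigma> \<and> \<sigma> 1 = 1"
  have "U (\<sigma> x) (\<sigma> y) \<le> \<sigma> (min x y)" if xy: "x \<in> {0..1}" "y \<in> {0..1}" for x y
  proof -
    have \<sigma>: "\<sigma> x \<in> {0..1}" "\<sigma> y \<in> {0..1}"
      using assms(3) xy by auto
    show ?thesis
    proof (cases "x \<in> B \<and> y \<in> B")
      case True
      then have "U (\<sigma> x) (\<sigma> y) = max (\<sigma> x) (\<sigma> y)"
        using uninorm_of_eq_max[OF assms(1,2)] unfolding U_def B_def by simp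
      \<comment> \<open>The points come in no fixed order here; either way the larger value of
        \<open>\<sigma>\<close> is taken at the smaller point.\<close>
      moreover have "x \<le> y \<Longrightarrow> \<sigma> y \<le> \<sigma> x" "y \<le> x \<Longrightarrow> \<sigma> x \<le> \<sigma> y"
        using R True by (auto dest: monotone_onD)
      ultimately show ?thesis
        by (auto simp: min_def)
    next
      case False
      then have "\<sigma> x < e \<or> \<sigma> y < e"
        using \<sigma> xy unfolding B_def by auto
      then have "U (\<sigma> x) (\<sigma> y) \<le> min (\<sigma> x) (\<sigma> y)"
        unfolding U_def using assms(1,2) \<sigma> by (intro uninorm_of_le_min) auto
      \<comment> \<open>Since \<open>min x y\<close> is one of \<open>x\<close> and
        \<open>y\<close>, \<open>\<sigma> (min x y)\<close> is one of the two values and so at least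
        their minimum.\<close>
      then show ?thesis
        by (auto simp: min_def split: if_splits)
    qed
  qed
  then show "fuzzy_t_subnorm U min \<sigma>"
    using R assms(3) unfolding fuzzy_t_subnorm_def by blast
qed

end
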